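(* Let $n\ge 1$ and let $\mathbb{S}^{n-1}\subset\mathbb{R}^n$ be the unit sphere. Let $P\subset\mathbb{S}^{n-1}$ be an A-type polytope. Then $\mathbf{I}_P$ cannot be equal to a linear combination of indicators of finitely many B-type polytopes; that is, there do not exist $k\ge 0$, B-type polytopes $Q_1,\dots,Q_k\subset\mathbb{S}^{n-1}$ and $\alpha_1,\dots,\alpha_k\in\mathbb{R}$ with $\mathbf{I}_P=\sum_{i=1}^k\alpha_i\mathbf{I}_{Q_i}$, where equality of functions means equality outside a set of measure zero.
   Context: A spherical polytope in the sphere $\mathbb{S}^{n-1}\subset\mathbb{R}^n$ (centre $0$) is the intersection of $\mathbb{S}^{n-1}$ with finitely many (possibly zero) closed halfspaces of $\mathbb{R}^n$ whose bounding hyperplanes all pass through the centre $0$. Polytopes considered here are full-dimensional: they have nonempty interior relative to $\mathbb{S}^{n-1}$. Such a polytope is called a B-type polytope if it contains both endpoints of some diameter of the sphere (i.e. contains $y$ and $-y$ for some $y\in\mathbb{S}^{n-1}$), and an A-type polytope otherwise. The indicator $\mathbf{I}_P:\mathbb{S}^{n-1}\to\mathbb{R}$ equals $1$ at all points of the interior of $P$ (relative to $\mathbb{S}^{n-1}$) and $0$ elsewhere. Two functions are regarded as equal if they agree outside a set of measure zero with respect to the surface (Lebesgue) measure on $\mathbb{S}^{n-1}$; for $n=1$, $\mathbb{S}^0=\{-1,1\}$ carries the counting measure. *)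

theory Defs
  imports "HOL-Analysis.Analysis"
begin

definition central_halfspace :: "(real^'n) set \<Rightarrow> bool" where
  "central_halfspace H \<longleftrightarrow> (\<exists>a. a \<noteq> 0 \<and> H = {x. a \<bullet> x \<le> 0})"

text \<open>Zero halfspaces are allowed: \<open>\<Inter>{} = UNIV\<close>, so the whole sphere is a spherical polytope.\<close>

definition spherical_polytope :: "(real^'n) set \<Rightarrow> bool" where
  "spherical_polytope P \<longleftrightarrow>
     (\<exists>\<H>. finite \<H> \<and> (\<forall>H\<in>\<H>. central_halfspace H) \<and> P = sphere 0 1 \<inter> \<Inter>\<H>)"

abbreviation sphere_interior :: "(real^'n) set \<Rightarrow> (real^'n) set" where
  "sphere_interior P \<equiv> top_of_set (sphere 0 1) interior_of P"

definition full_dim_polytope :: "(real^'n) set \<Rightarrow> bool" where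
  "full_dim_polytope P \<longleftrightarrow> spherical_polytope P \<and> sphere_interior P \<noteq> {}"

definition B_type :: "(real^'n) set \<Rightarrow> bool" where
  "B_type P \<longleftrightarrow> full_dim_polytope P \<and> (\<exists>y\<in>sphere 0 1. y \<in> P \<and> - y \<in> P)"

definition A_type :: "(real^'n) set \<Rightarrow> bool" where
  "A_type P \<longleftrightarrow> full_dim_polytope P \<and> \<not> (\<exists>y\<in>sphere 0 1. y \<in> P \<and> - y \<in> P)"

definition poly_ind :: "(real^'n) set \<Rightarrow> real^'n \<Rightarrow> real" where
  "poly_ind P = indicator (sphere_interior P)"

text \<open>
  Surface measure on the unit sphere, in the polar-coordinates normalisation
  \<open>\<sigma>(A) = n \<cdot> vol {t u | u \<in> A, 0 < t < 1}\<close>: the image of \<open>n\<close> times Lebesgue measure on the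
  punctured unit ball under the radial projection \<open>x \<mapsto> x / \<parallel>x\<parallel>\<close> (which is \<open>sgn\<close>).
  For \<open>n = 1\<close> it is the counting measure on \<open>{-1, 1}\<close>; see the last lemma below.
\<close>

definition surface_measure :: "(real^'n) measure" where
  "surface_measure =
     scale_measure (of_nat CARD('n))
       (distr (restrict_space lborel (ball 0 1 - {0})) (restrict_space borel (sphere 0 1)) sgn)"

lemma space_surface_measure: "space surface_measure = sphere 0 1"
  by (simp add: surface_measure_def space_scale_measure space_restrict_space)

lemma sets_surface_measure: "sets surface_measure = sets (restrict_space borel (sphere 0 1))"
  by (simp add: surface_measure_def)

lemma measurable_radial_projection:
  "sgn \<in> restrict_space lborel (ball 0 1 - {0}) \<rightarrow>\<^sub>M restrict_space borel (sphere (0::real^'n) 1)"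
proof (rule measurable_restrict_space2)
  show "sgn \<in> space (restrict_space lborel (ball 0 1 - {0})) \<rightarrow> sphere (0::real^'n) 1"
    by (auto simp: space_restrict_space norm_sgn)
  have "continuous_on (ball 0 1 - {0}) (sgn :: real^'n \<Rightarrow> real^'n)"
    unfolding sgn_div_norm by (intro continuous_intros) auto
  then have "sgn \<in> restrict_space borel (ball 0 1 - {0}) \<rightarrow>\<^sub>M (borel :: (real^'n) measure)"
    by (rule borel_measurable_continuous_on_restrict)
  then show "sgn \<in> restrict_space lborel (ball 0 1 - {0}) \<rightarrow>\<^sub>M (borel :: (real^'n) measure)"
    by (simp cong: measurable_cong_sets add: sets_restrict_space)
qed

lemma emeasure_surface_measure:
  fixes A :: "(real^'n) set"
  assumes "A \<in> sets surface_measure"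
  shows "emeasure surface_measure A =
    of_nat CARD('n) * emeasure lborel {t *\<^sub>R u |t u. u \<in> A \<and> 0 < t \<and> t < 1}"
proof -
  let ?B = "ball 0 1 - {0} :: (real^'n) set"
  have A: "A \<in> sets (restrict_space borel (sphere 0 1))"
    using assms by (simp add: sets_surface_measure)
  then have sub: "A \<subseteq> sphere 0 1"
    using sets.sets_into_space[OF A] by (simp add: space_restrict_space)
  have cone: "sgn -` A \<inter> ?B = {t *\<^sub>R u |t u. u \<in> A \<and> 0 < t \<and> t < 1}" (is "?L = ?R")
  proof
    show "?L \<subseteq> ?R"
    proof
      fix x assume x: "x \<in> ?L"
      then have "x = norm x *\<^sub>R sgn x" by (simp add: sgn_div_norm)
      with x show "x \<in> ?R" by fastforce
    qed
    show "?R \<subseteq> ?L"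
    proof
      fix x assume "x \<in> ?R"
      then obtain t u where tu: "x = t *\<^sub>R u" "u \<in> A" "0 < t" "t < 1" by blast
      with sub have "norm u = 1" by auto
      with tu have "sgn x = u" "norm x = t" by (simp_all add: sgn_div_norm)
      with tu show "x \<in> ?L" by auto
    qed
  qed
  have "emeasure surface_measure A =
      of_nat CARD('n) * emeasure (restrict_space lborel ?B) (sgn -` A \<inter> ?B)"
    using emeasure_distr[OF measurable_radial_projection A]
    by (simp add: surface_measure_def space_restrict_space)
  also have "emeasure (restrict_space lborel ?B) (sgn -` A \<inter> ?B) = emeasure lborel (sgn -` A \<inter> ?B)"
    by (rule emeasure_restrict_space) auto
  finally show ?thesis by (simp add: cone)
qed

lemma surface_measure_dim1:
  fixes u :: "real^'n"
  assumes n1: "CARD('n) = 1" and u: "u \<in> sphere 0 1"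
  shows "emeasure surface_measure {u} = 1"
proof -
  obtain i :: 'n where i: "UNIV = {i}"
    using n1 by (metis card_1_singletonE)
  have all_i: "(\<forall>j. Q j) \<longleftrightarrow> Q i" for Q :: "'n \<Rightarrow> bool"
    using i by (metis UNIV_I singletonD)
  have "norm u = \<bar>u $ i\<bar>"
    by (simp add: norm_vec_def L2_set_def i)
  with u have ui: "u $ i = 1 \<or> u $ i = - 1" by auto
  have "{u} \<in> sets surface_measure"
    using u by (auto simp: sets_surface_measure sets_restrict_space_iff)
  then have em: "emeasure surface_measure {u} =
      of_nat CARD('n) * emeasure lborel {t *\<^sub>R v |t v. v \<in> {u} \<and> 0 < t \<and> t < 1}"
    by (rule emeasure_surface_measure)
  have basis: "(Basis :: (real^'n) set) = {axis i 1}"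
    by (auto simp: Basis_vec_def i)
  show ?thesis
  proof (cases "u $ i = 1")
    case True
    have "{t *\<^sub>R v |t v. v \<in> {u} \<and> 0 < t \<and> t < 1} = box 0 (vec 1)"
    proof (intro set_eqI iffI)
      fix x assume "x \<in> box 0 (vec 1 :: real^'n)"
      then have "x = (x $ i) *\<^sub>R u \<and> 0 < x $ i \<and> x $ i < 1"
        by (simp add: mem_box_cart all_i vec_eq_iff True)
      then show "x \<in> {t *\<^sub>R v |t v. v \<in> {u} \<and> 0 < t \<and> t < 1}" by blast
    qed (auto simp: mem_box_cart all_i True)
    then show ?thesis
      using em n1 by (simp add: emeasure_lborel_box_eq basis inner_axis)
  next
    case False
    with ui have F: "u $ i = - 1" by simp
    have "{t *\<^sub>R v |t v. v \<in> {u} \<and> 0 < t \<and> t < 1} = box (vec (- 1)) 0"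
    proof (intro set_eqI iffI)
      fix x assume "x \<in> box (vec (- 1) :: real^'n) 0"
      then have "x = (- (x $ i)) *\<^sub>R u \<and> 0 < - (x $ i) \<and> - (x $ i) < 1"
        by (simp add: mem_box_cart all_i vec_eq_iff F)
      then show "x \<in> {t *\<^sub>R v |t v. v \<in> {u} \<and> 0 < t \<and> t < 1}" by blast
    qed (auto simp: mem_box_cart all_i F)
    then show ?thesis
      using em n1 by (simp add: emeasure_lborel_box_eq basis inner_axis)
  qed
qed

end

theory Submission
  imports Defs
begin

text \<open>
  The cone over a B-type polytope is invariant under translation along the diameter it contains,
  so applying to the relation the difference operators \<open>f \<mapsto> f (\<cdot> + y) - f\<close> for all these
  diameters annihilates the right-hand side. On functions supported in a halfspace whose boundary
  is transversal to \<open>y\<close> such an operator is injective (up to null sets), since a \<open>y\<close>-periodic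
  function of that kind vanishes. As the cone over an A-type polytope contains no line, the
  indicator of this cone remains in the domain of injectivity for every diameter, hence
  vanishes almost everywhere, contradicting full-dimensionality.
\<close>

lemma negligible_shift:
  fixes y :: "'a::euclidean_space"
  assumes "negligible {x. R x}"
  shows "negligible {x. R (x + y)}"
proof -
  have "{x. R (x + y)} = (+) (- y) ` {x. R x}"
  proof (intro set_eqI iffI)
    fix x assume "x \<in> {x. R (x + y)}"
    then show "x \<in> (+) (- y) ` {x. R x}"
      by (intro image_eqI[of _ _ "x + y"]) auto
  qed auto
  with assms show ?thesis by (simp only: negligible_translation)
qed

text \<open>Enough steps along \<open>y\<close> or \<open>- y\<close> carry any point into the
  halfspace where \<open>f\<close> vanishes. Countably many steps are involved, so the exceptional
  null sets have a null union.\<close>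

lemma negligible_of_periodic:
  fixes f :: "'a::euclidean_space \<Rightarrow> real"
  assumes per: "negligible {x. f (x + y) \<noteq> f x}"
    and supp: "\<And>x. a \<bullet> x > c \<Longrightarrow> f x = 0"
    and "a \<bullet> y \<noteq> 0"
  shows "negligible {x. f x \<noteq> 0}"
proof -
  \<comment> \<open>\<open>z\<close> is whichever of \<open>y\<close> and \<open>- y\<close>
    increases \<open>a \<bullet> x\<close>; translating the null set turns a period \<open>y\<close>
    into a period \<open>- y\<close>.\<close>
  obtain z where per': "negligible {x. f (x + z) \<noteq> f x}" and z: "a \<bullet> z > 0"
  proof (cases "a \<bullet> y > 0")
    case False
    have "negligible {x. f (x + - y) \<noteq> f x}"
      using negligible_shift[OF per, of "- y"] by (simp add: eq_commute)
    moreover have "a \<bullet> (- y) > 0" using False \<open>a \<bullet> y \<noteq> 0\<close> by simp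
    ultimately show ?thesis by (rule that)
  qed (use per that in blast)
  have "negligible {x. f (x + real m *\<^sub>R z) \<noteq> f x}" for m
  proof (induction m)
    case (Suc m)
    have "{x. f (x + real (Suc m) *\<^sub>R z) \<noteq> f x}
        \<subseteq> {x. f (x + z) \<noteq> f x} \<union> {x. f (x + z + real m *\<^sub>R z) \<noteq> f (x + z)}"
      by (auto simp: algebra_simps)
    then show ?case
      using per' negligible_shift[OF Suc.IH, of z] by (meson negligible_Un negligible_subset)
  qed simp
  then have "negligible (\<Union>m. {x. f (x + real m *\<^sub>R z) \<noteq> f x})"
    by (rule negligible_Union_nat)
  moreover have "{x. f x \<noteq> 0} \<subseteq> (\<Union>m. {x. f (x + real m *\<^sub>R z) \<noteq> f x})"
  proof
    fix x assume x: "x \<in> {x. f x \<noteq> 0}"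
    obtain m :: nat where "c - a \<bullet> x < real m * (a \<bullet> z)"
      using reals_Archimedean3[OF z] by blast
    then have "f (x + real m *\<^sub>R z) = 0"
      by (intro supp) (simp add: inner_add_right)
    with x show "x \<in> (\<Union>m. {x. f (x + real m *\<^sub>R z) \<noteq> f x})" by (intro UN_I[of m]) auto
  qed
  ultimately show ?thesis by (rule negligible_subset)
qed

text \<open>Induction on \<open>I\<close>: differencing along \<open>y j\<close> removes the
  \<open>j\<close>-th term and preserves the other periods and the vanishing of \<open>f\<close> on
  far halfspaces. The induction hypothesis then makes \<open>f\<close> periodic along
  \<open>y j\<close> almost everywhere. The bound \<open>c\<close> is existential because
  differencing may enlarge it.\<close>

lemma negligible_of_sum_periodic:
  fixes f :: "'a::euclidean_space \<Rightarrow> real" and g :: "'i \<Rightarrow> 'a \<Rightarrow> real"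
  assumes "finite I"
    and "negligible {x. f x \<noteq> (\<Sum>i\<in>I. g i x)}"
    and "\<And>i x. i \<in> I \<Longrightarrow> g i (x + y i) = g i x"
    and "\<And>a. a \<in> A \<Longrightarrow> \<exists>c. \<forall>x. a \<bullet> x > c \<longrightarrow> f x = 0"
    and "\<And>i. i \<in> I \<Longrightarrow> \<exists>a\<in>A. a \<bullet> y i \<noteq> 0"
  shows "negligible {x. f x \<noteq> 0}"
  using assms
proof (induction I arbitrary: f g rule: finite_induct)
  case (insert j I)
  define D where "D h x = h (x + y j) - h x" for h :: "'a \<Rightarrow> real" and x
  have "negligible {x. D f x \<noteq> 0}"
  proof (rule insert.IH)
    have "{x. D f x \<noteq> (\<Sum>i\<in>I. D (g i) x)} \<subseteq> {x. f x \<noteq> (\<Sum>i\<in>insert j I. g i x)}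
        \<union> {x. f (x + y j) \<noteq> (\<Sum>i\<in>insert j I. g i (x + y j))}"
      \<comment> \<open>The exact period of \<open>g j\<close> gives \<open>D (g j) x = 0\<close>,
        so only the sum over \<open>I\<close> survives.\<close>
      using insert.hyps insert.prems(2)[of j] by (auto simp: D_def sum_subtractf)
    then show "negligible {x. D f x \<noteq> (\<Sum>i\<in>I. D (g i) x)}"
      using insert.prems(1) negligible_shift[OF insert.prems(1), of "y j"]
      by (meson negligible_Un negligible_subset)
  next
    fix i x assume "i \<in> I"
    then show "D (g i) (x + y i) = D (g i) x"
      using insert.prems(2)[of i x] insert.prems(2)[of i "x + y j"]
      by (simp add: D_def algebra_simps)
  next
    fix a assume "a \<in> A"
    then obtain c where c: "\<And>x. a \<bullet> x > c \<Longrightarrow> f x = 0" using insert.prems(3) by blast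
    \<comment> \<open>The maximum ensures that \<open>x\<close> and \<open>x + y j\<close> both lie
      where \<open>f\<close> vanishes.\<close>
    have "D f x = 0" if "a \<bullet> x > max c (c - a \<bullet> y j)" for x
      using that by (simp add: D_def c inner_add_right)
    then show "\<exists>c. \<forall>x. a \<bullet> x > c \<longrightarrow> D f x = 0" by blast
  qed (use insert.prems(4) in blast)
  then have per: "negligible {x. f (x + y j) \<noteq> f x}" by (simp add: D_def)
  obtain a where a: "a \<in> A" "a \<bullet> y j \<noteq> 0" using insert.prems(4) by blast
  obtain c where "\<And>x. a \<bullet> x > c \<Longrightarrow> f x = 0" using insert.prems(3) a(1) by blast
  then show ?case using negligible_of_periodic[OF per _ a(2)] by blast
qed simp

text \<open>The surface measure is a scaled image of Lebesgue measure under \<open>sgn\<close>, so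
  null sets pull back to null sets in the punctured ball; integer dilates of these cover the full
  cone.\<close>

lemma negligible_cone_if_AE_surface_measure:
  assumes "AE x in surface_measure. R (x :: real^'n)"
  shows "negligible {x. x \<noteq> 0 \<and> \<not> R (sgn x)}"
proof -
  let ?B = "ball 0 1 - {0} :: (real^'n) set"
  let ?D = "distr (restrict_space lborel ?B) (restrict_space borel (sphere 0 1)) sgn"
  obtain N where N: "{x \<in> space ?D. \<not> R x} \<subseteq> N" "N \<in> sets ?D"
      and "emeasure surface_measure N = 0"
    using assms
    by (auto elim!: AE_E simp: surface_measure_def space_scale_measure)
  \<comment> \<open>The factor \<open>CARD('n)\<close> is positive, so scaling keeps the same null
    sets.\<close>
  then have "emeasure ?D N = 0" by (simp add: surface_measure_def)
  with N have "AE x in ?D. R x" by (intro AE_I)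
  then have "AE x in restrict_space lborel ?B. R (sgn x)"
    by (rule AE_distrD[OF measurable_radial_projection])
  then have "AE x in lborel. x \<in> ?B \<longrightarrow> R (sgn x)"
    by (subst (asm) AE_restrict_space_iff) auto
  then have "AE x in lebesgue. x \<in> ?B \<longrightarrow> R (sgn x)" by (rule AE_completion)
  then have neg: "negligible {x \<in> ?B. \<not> R (sgn x)}"
    by (auto simp: eventually_ae_filter_negligible intro: negligible_subset)
  have "negligible (\<Union>m. (*\<^sub>R) (real (Suc m)) ` {x \<in> ?B. \<not> R (sgn x)})"
    by (intro negligible_Union_nat negligible_differentiable_image_negligible[OF _ neg]
        linear_imp_differentiable_on linear_scaleR) simp
  moreover have "{x. x \<noteq> 0 \<and> \<not> R (sgn x)}
      \<subseteq> (\<Union>m. (*\<^sub>R) (real (Suc m)) ` {x \<in> ?B. \<not> R (sgn x)})"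
  proof
    fix x assume x: "x \<in> {x. x \<noteq> 0 \<and> \<not> R (sgn x)}"
    obtain m where m: "norm x < real (Suc m)"
      by (metis reals_Archimedean2 less_trans of_nat_less_iff lessI)
    let ?x = "inverse (real (Suc m)) *\<^sub>R x"
    have "x = real (Suc m) *\<^sub>R ?x" by simp
    moreover have "?x \<in> {x \<in> ?B. \<not> R (sgn x)}"
      using x m by (simp add: sgn_scaleR field_simps)
    ultimately show "x \<in> (\<Union>m. (*\<^sub>R) (real (Suc m)) ` {x \<in> ?B. \<not> R (sgn x)})" by blast
  qed
  ultimately show ?thesis by (rule negligible_subset)
qed

text \<open>This is the polar cone of \<open>A\<close>, whose elements serve as outer normals of
  halfspaces.\<close>

definition dual_cone :: "'a::euclidean_space set \<Rightarrow> 'a set" where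
  "dual_cone A = {x. \<forall>a\<in>A. a \<bullet> x \<le> 0}"

lemma spherical_polytopeE:
  assumes "spherical_polytope P"
  obtains A where "P = sphere 0 1 \<inter> dual_cone A"
proof -
  obtain \<H> where \<H>: "\<forall>H\<in>\<H>. central_halfspace H" "P = sphere 0 1 \<inter> \<Inter>\<H>"
    using assms unfolding spherical_polytope_def by blast
  then obtain n where "\<forall>H\<in>\<H>. H = {x. n H \<bullet> x \<le> 0}"
    unfolding central_halfspace_def by metis
  then have "\<Inter>\<H> = dual_cone (n ` \<H>)" unfolding dual_cone_def by auto
  with \<H>(2) that show thesis by blast
qed

text \<open>Convexity is what makes the frontier of the cone a null set.\<close>

lemma convex_dual_cone: "convex (dual_cone A)"
proof -
  have "dual_cone A = (\<Inter>a\<in>A. {x. a \<bullet> x \<le> 0})" by (auto simp: dual_cone_def)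
  then show ?thesis by (auto intro!: convex_INT convex_halfspace_le)
qed

lemma scaleR_mem_dual_cone_iff: "t > 0 \<Longrightarrow> t *\<^sub>R x \<in> dual_cone A \<longleftrightarrow> x \<in> dual_cone A"
  by (simp add: dual_cone_def mult_le_0_iff)

lemma sgn_mem_dual_cone_iff: "x \<noteq> 0 \<Longrightarrow> sgn x \<in> dual_cone A \<longleftrightarrow> x \<in> dual_cone A"
  by (simp add: sgn_div_norm scaleR_mem_dual_cone_iff)

lemma open_sgn_vimage:
  assumes "open (T :: 'a::euclidean_space set)"
  shows "open {x. x \<noteq> 0 \<and> sgn x \<in> T}"
proof -
  have "continuous_on (- {0}) (sgn :: 'a \<Rightarrow> 'a)"
    unfolding sgn_div_norm by (intro continuous_intros) auto
  then have "open (- {0} \<inter> sgn -` T)"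
    using assms by (intro continuous_open_preimage) auto
  moreover have "- {0} \<inter> sgn -` T = {x. x \<noteq> 0 \<and> sgn x \<in> T}" by auto
  ultimately show ?thesis by simp
qed

lemma sphere_interior_iff:
  "u \<in> sphere_interior P \<longleftrightarrow> (\<exists>T. open T \<and> u \<in> T \<inter> sphere 0 1 \<and> T \<inter> sphere 0 1 \<subseteq> P)"
proof
  assume "u \<in> sphere_interior P"
  then obtain T where "open T" "u \<in> sphere 0 1 \<inter> T" "sphere 0 1 \<inter> T \<subseteq> P"
    unfolding interior_of_def openin_open by blast
  then show "\<exists>T. open T \<and> u \<in> T \<inter> sphere 0 1 \<and> T \<inter> sphere 0 1 \<subseteq> P" by blast
next
  assume "\<exists>T. open T \<and> u \<in> T \<inter> sphere 0 1 \<and> T \<inter> sphere 0 1 \<subseteq> P"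
  then obtain T where "open T" "u \<in> sphere 0 1 \<inter> T" "sphere 0 1 \<inter> T \<subseteq> P" by blast
  then show "u \<in> sphere_interior P"
    unfolding interior_of_def openin_open by blast
qed

text \<open>Off the frontier, a point of the cone has a neighbourhood inside it, and dividing by
  \<open>norm x\<close> moves this neighbourhood to \<open>sgn x\<close> without leaving the
  cone.\<close>

lemma poly_ind_sgn:
  assumes "x \<notin> frontier (dual_cone A)" "x \<noteq> 0"
  shows "poly_ind (sphere 0 1 \<inter> dual_cone A) (sgn x) = indicator (dual_cone A) x"
proof (cases "x \<in> dual_cone A")
  case True
  then have "x \<in> interior (dual_cone A)"
    using assms(1) closure_subset unfolding frontier_def by blast
  then obtain T where T: "open T" "x \<in> T" "T \<subseteq> dual_cone A"
    by (meson interiorE)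
  let ?T = "(*\<^sub>R) (inverse (norm x)) ` T"
  have "open ?T" using T assms(2) by (intro open_scaling) auto
  moreover have "sgn x \<in> ?T \<inter> sphere 0 1"
    using T(2) assms(2) by (auto simp: sgn_div_norm)
  moreover have "?T \<subseteq> dual_cone A"
    using T(3) assms(2) by (auto simp: scaleR_mem_dual_cone_iff)
  ultimately have "sgn x \<in> sphere_interior (sphere 0 1 \<inter> dual_cone A)"
    unfolding sphere_interior_iff by blast
  with True show ?thesis by (simp add: poly_ind_def)
next
  case False
  then have "sgn x \<notin> sphere_interior (sphere 0 1 \<inter> dual_cone A)"
    using assms(2) interior_of_subset by (fastforce simp: sgn_mem_dual_cone_iff)
  with False show ?thesis by (simp add: poly_ind_def)
qed

text \<open>The cone over a relatively open patch of the sphere is open and nonempty.\<close>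

lemma not_negligible_dual_cone:
  assumes "sphere_interior (sphere 0 1 \<inter> dual_cone A) \<noteq> {}"
  shows "\<not> negligible (dual_cone A)"
proof -
  obtain u T where T: "open T" "u \<in> T" "u \<in> sphere 0 1" "T \<inter> sphere 0 1 \<subseteq> dual_cone A"
    using assms by (auto simp: sphere_interior_iff set_eq_iff)
  let ?U = "{x. x \<noteq> 0 \<and> sgn x \<in> T}"
  have "u \<in> ?U" using T(2,3) by (auto simp: sgn_div_norm)
  then have "\<not> negligible ?U" using open_not_negligible[OF open_sgn_vimage[OF T(1)]] by blast
  moreover have "?U \<subseteq> dual_cone A"
    using T(4) by (force simp: norm_sgn simp flip: sgn_mem_dual_cone_iff)
  ultimately show ?thesis using negligible_subset by blast
qed

text \<open>This turns both polytope types into conditions on normals: a diameter in the polytope is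
  a direction orthogonal to all of them.\<close>

lemma antipodal_mem_dual_cone_iff:
  "y \<in> dual_cone A \<and> - y \<in> dual_cone A \<longleftrightarrow> (\<forall>a\<in>A. a \<bullet> y = 0)"
  by (auto simp: dual_cone_def order_antisym_conv)

theorem theorem2p1:
  fixes P :: "(real^'n) set"
  assumes "A_type P"
  shows "\<not> (\<exists>(k::nat) (Q :: nat \<Rightarrow> (real^'n) set) (\<alpha> :: nat \<Rightarrow> real).
           (\<forall>i\<in>{1..k}. B_type (Q i)) \<and>
           (AE x in surface_measure. poly_ind P x = (\<Sum>i=1..k. \<alpha> i * poly_ind (Q i) x)))"
proof (intro notI, elim exE conjE)
  fix k :: nat and Q :: "nat \<Rightarrow> (real^'n) set" and \<alpha> :: "nat \<Rightarrow> real"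
  assume B: "\<forall>i\<in>{1..k}. B_type (Q i)"
    and ae: "AE x in surface_measure. poly_ind P x = (\<Sum>i=1..k. \<alpha> i * poly_ind (Q i) x)"
  obtain A where P: "P = sphere 0 1 \<inter> dual_cone A"
    using assms spherical_polytopeE unfolding A_type_def full_dim_polytope_def by metis
  have "\<forall>i\<in>{1..k}. \<exists>C y. Q i = sphere 0 1 \<inter> dual_cone C \<and> y \<in> sphere 0 1 \<and> (\<forall>c\<in>C. c \<bullet> y = 0)"
    using B unfolding B_type_def full_dim_polytope_def
    by (metis IntD2 spherical_polytopeE antipodal_mem_dual_cone_iff)
  then obtain C y where Q: "\<And>i. i \<in> {1..k} \<Longrightarrow> Q i = sphere 0 1 \<inter> dual_cone (C i)"
    and y: "\<And>i. i \<in> {1..k} \<Longrightarrow> y i \<in> sphere 0 1" "\<And>i c. i \<in> {1..k} \<Longrightarrow> c \<in> C i \<Longrightarrow> c \<bullet> y i = 0"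
    by metis
  let ?f = "indicator (dual_cone A) :: real^'n \<Rightarrow> real"
  let ?g = "\<lambda>i x. \<alpha> i * indicator (dual_cone (C i)) x"
  \<comment> \<open>\<open>?N\<close> is the null set inherited from the sphere; \<open>?E\<close>
    holds the points where polytope and cone indicators may disagree.\<close>
  let ?N = "{x. x \<noteq> 0 \<and> poly_ind P (sgn x) \<noteq> (\<Sum>i=1..k. \<alpha> i * poly_ind (Q i) (sgn x))}"
  let ?E = "{0} \<union> frontier (dual_cone A) \<union> (\<Union>i\<in>{1..k}. frontier (dual_cone (C i)))"
  have "negligible {x. ?f x \<noteq> 0}"
  proof (rule negligible_of_sum_periodic)
    have "negligible (?N \<union> ?E)"
      using negligible_cone_if_AE_surface_measure[OF ae]
      by (auto intro!: negligible_Union negligible_Un negligible_convex_frontier convex_dual_cone)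
    moreover have "{x. ?f x \<noteq> (\<Sum>i=1..k. ?g i x)} \<subseteq> ?N \<union> ?E"
    proof (rule subsetI, rule ccontr)
      fix x assume x: "x \<in> {x. ?f x \<noteq> (\<Sum>i=1..k. ?g i x)}" "x \<notin> ?N \<union> ?E"
      then have "poly_ind P (sgn x) = ?f x"
        unfolding P by (intro poly_ind_sgn) auto
      moreover have "(\<Sum>i=1..k. \<alpha> i * poly_ind (Q i) (sgn x)) = (\<Sum>i=1..k. ?g i x)"
        using x(2) by (intro sum.cong) (auto simp: Q poly_ind_sgn)
      ultimately show False using x by auto
    qed
    ultimately show "negligible {x. ?f x \<noteq> (\<Sum>i=1..k. ?g i x)}" by (rule negligible_subset)
  next
    fix i x assume "i \<in> {1..k}"
    \<comment> \<open>Moving along \<open>y i\<close> changes no inner product with a normal in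
      \<open>C i\<close>.\<close>
    then show "?g i (x + y i) = ?g i x"
      using y(2) by (simp add: dual_cone_def indicator_def inner_add_right)
  next
    fix a assume "a \<in> A"
    then have "\<forall>x. a \<bullet> x > 0 \<longrightarrow> ?f x = 0" by (force simp: dual_cone_def indicator_def)
    then show "\<exists>c. \<forall>x. a \<bullet> x > c \<longrightarrow> ?f x = 0" by blast
  next
    fix i assume "i \<in> {1..k}"
    \<comment> \<open>Otherwise \<open>P\<close> would contain both \<open>y i\<close> and
      \<open>- y i\<close>, contrary to being of A-type.\<close>
    then show "\<exists>a\<in>A. a \<bullet> y i \<noteq> 0"
      using assms y(1)[of i] antipodal_mem_dual_cone_iff[of "y i" A] by (auto simp: A_type_def P)
  qed simp
  then have "negligible (dual_cone A)" by (simp add: indicator_eq_0_iff)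
  moreover have "\<not> negligible (dual_cone A)"
    using assms not_negligible_dual_cone unfolding A_type_def full_dim_polytope_def P by blast
  ultimately show False by blast
qed

end
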